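(* Let $X\subseteq\mathbb{R}^n$, let $f$ be a real-valued objective function on $\mathbb{R}^n$, let $g_1(x,u),\dots,g_s(x,u)$ and $h_1(x,u),\dots,h_m(x,u)$ be real functions of $(x,u)\in\mathbb{R}^n\times\mathbb{R}^p$ as in the context, and let $$U(x)=\{u\in\mathbb{R}^p:\ h_1(x,u)\ge 0,\dots,h_m(x,u)\ge 0\}.$$ For each $x\in X$, assume every $g_j(x,u)$ is convex in $u$ and every $h_i(x,u)$ is concave in $u$. Let $T(x,u)$ be a matrix polynomial and $\psi(x,u)$ a nonzero polynomial with $T(x,u)H(x,u)=\psi(x,u)I_m$, and let $p_j(x,u)=\frac{1}{\psi(x,u)}T(x,u)\eta_j(x,u)$ for $j=1,\dots,s$, with $H$ and $\eta_j$ as in the context. Assume that for each $x\in X$ and each $j\in\{1,\dots,s\}$ the optimal value of $$\min_{u}\ g_j(x,u)\quad\text{s.t.}\quad h(x,u)\ge 0$$ is achieved at a KKT point $z_j$ and that the corresponding Lagrange multiplier vector is $\lambda_j=p_j(x,z_j)$. Then the generalized semi-infinite program $$\min\ f(x)\quad\text{s.t.}\quad g_j(x,u)\ge 0\ \ \forall u\in U(x),\ j=1,\dots,s,\quad x\in X$$ is equivalent to the optimization problem $$\begin{array}{cl}\min\limits_{x,z_1,\dots,z_s} & f(x)\\ \text{s.t.} & \nabla_u h(x,z_j)\,p_j(x,z_j)=\nabla_u g_j(x,z_j),\quad j=1,\dots,s,\\ & 0\le h(x,z_j)\perp p_j(x,z_j)\ge 0,\quad j=1,\dots,s,\\ & g_j(x,z_j)\ge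 0,\quad j=1,\dots,s,\\ & x\in X,\end{array}$$ in the variables $x\in\mathbb{R}^n$, $z_j\in\mathbb{R}^p$; that is, $x$ is feasible for the former if and only if there exist $z_1,\dots,z_s$ such that $(x,z_1,\dots,z_s)$ is feasible for the latter (so the two problems have the same optimal value and the same minimizing $x$).
   Context: $X\subseteq\mathbb{R}^n$ is given by finitely many polynomial equalities and inequalities and $f$ is a polynomial. The functions $g_j,h_i$ are polynomials, or more generally rational functions, in $(x,u)$; for $x\in X$ they are taken to be defined and differentiable in $u$. Notation: $h(x,u)=(h_1(x,u),\dots,h_m(x,u))^T$; $\nabla_u$ is the gradient in $u$; $\nabla_u h(x,z)=[\nabla_u h_1(x,z)\ \cdots\ \nabla_u h_m(x,z)]\in\mathbb{R}^{p\times m}$ is the transposed Jacobian of $h(x,\cdot)$ at $u=z$. The notation $0\le a\perp b\ge 0$ for vectors $a,b$ means $a\ge 0$, $b\ge 0$ entrywise and $a^Tb=0$. A point $z_j$ is a KKT point of the problem $\min_u g_j(x,u)$ s.t. $h(x,u)\ge 0$, with Lagrange multiplier vector $\lambda_j\in\mathbb{R}^m$, if $\nabla_u h(x,z_j)\lambda_j=\nabla_u g_j(x,z_j)$ and $0\le h(x,z_j)\perp\lambda_j\ge 0$. The $(p+m)\times m$ matrix $H$ and the vectors $\eta_j$ of length $p+m$ ($j=1,\dots,s$) are $$H(x,u)=\begin{bmatrix}\nabla_u h_1&\nabla_u h_2&\cdots&\nabla_u h_m\\ h_1&0&\cdots&0\\ 0&h_2&\cdots&0\\ \vdots&\vdots&\ddots&\vdots\\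 0&0&\cdots&h_m\end{bmatrix},\qquad \eta_j(x,u)=\begin{bmatrix}\nabla_u g_j\\0\\\vdots\\0\end{bmatrix},$$ all entries evaluated at $(x,u)$; $T(x,u)$ is an $m\times(p+m)$ matrix of polynomials and $I_m$ is the identity matrix. The assumption $\lambda_j=p_j(x,z_j)$ includes that $p_j$ is defined there, i.e. $\psi(x,z_j)\ne 0$; likewise, points feasible for the second problem are understood to satisfy $\psi(x,z_j)\neq0$, so that $p_j(x,z_j)$ is defined. *)

theory Defs
  imports "HOL-Analysis.Analysis"
begin

text \<open>Over the reals, polynomials and polynomial functions coincide, so a polynomial in
  \<open>(x, u)\<close> is rendered as a curried function that is a \<^const>\<open>real_polynomial_function\<close>
  of the pair.\<close>

definition poly2 ::
  "('a::real_normed_vector \<Rightarrow> 'b::real_normed_vector \<Rightarrow> real) \<Rightarrow> bool" where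
  "poly2 q \<longleftrightarrow> real_polynomial_function (\<lambda>(x, u). q x u)"

text \<open>\<open>q\<close> is a rational function with denominator \<open>d\<close>. The value of \<open>q\<close> at zeros of \<open>d\<close>, where
  the rational function is undefined, is left arbitrary. A polynomial is the case \<open>d = 1\<close>.\<close>

definition rational2 ::
  "('a::real_normed_vector \<Rightarrow> 'b::real_normed_vector \<Rightarrow> real) \<Rightarrow> ('a \<Rightarrow> 'b \<Rightarrow> real) \<Rightarrow> bool" where
  "rational2 q d \<longleftrightarrow> poly2 d \<and> (\<exists>x u. d x u \<noteq> 0) \<and>
     (\<exists>a. poly2 a \<and> (\<forall>x u. d x u \<noteq> 0 \<longrightarrow> q x u = a x u / d x u))"

definition polynomial_constraint_set :: "'a::real_normed_vector set \<Rightarrow> bool" where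
  "polynomial_constraint_set X \<longleftrightarrow>
     (\<exists>E W S. finite E \<and> finite W \<and> finite S \<and>
        (\<forall>c \<in> E \<union> W \<union> S. real_polynomial_function c) \<and>
        X = {x. (\<forall>c\<in>E. c x = 0) \<and> (\<forall>c\<in>W. c x \<ge> 0) \<and> (\<forall>c\<in>S. c x > 0)})"

text \<open>The gradient vector; meaningful only where \<open>f\<close> is differentiable.\<close>

definition gradient :: "('a::real_inner \<Rightarrow> real) \<Rightarrow> 'a \<Rightarrow> 'a" where
  "gradient f u = (THE D. GDERIV f u :> D)"

lemma gradient_eqI:
  assumes "GDERIV f u :> D"
  shows "gradient f u = D"
  unfolding gradient_def
proof (rule the_equality)
  show "GDERIV f u :> D" by (rule assms)
next
  fix D' assume "GDERIV f u :> D'"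
  then have "(\<lambda>h. h \<bullet> D') = (\<lambda>h. h \<bullet> D)"
    using assms unfolding gderiv_def by (rule has_derivative_unique)
  then have "\<forall>h. h \<bullet> D' = h \<bullet> D" by (simp add: fun_eq_iff)
  then show "D' = D" by (simp only: vector_eq_ldot)
qed

definition complementary :: "real ^ 'm \<Rightarrow> real ^ 'm \<Rightarrow> bool" where
  "complementary a b \<longleftrightarrow> (\<forall>i. 0 \<le> a $ i) \<and> (\<forall>i. 0 \<le> b $ i) \<and> a \<bullet> b = 0"

definition grad_u ::
  "('x \<Rightarrow> real ^ 'p \<Rightarrow> real ^ 'm) \<Rightarrow> 'x \<Rightarrow> real ^ 'p \<Rightarrow> real ^ 'm ^ 'p" where
  "grad_u h x z = (\<chi> k i. gradient (\<lambda>u. h x u $ i) z $ k)"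

definition U_set :: "('x \<Rightarrow> real ^ 'p \<Rightarrow> real ^ 'm) \<Rightarrow> 'x \<Rightarrow> (real ^ 'p) set" where
  "U_set h x = {u. \<forall>i. h x u $ i \<ge> 0}"

text \<open>KKT conditions at \<open>z\<close> with multiplier vector \<open>l\<close> for minimizing \<open>g x u\<close> over \<open>u\<close> subject to
  \<open>h x u \<ge> 0\<close>.\<close>

definition KKT ::
  "('x \<Rightarrow> real ^ 'p \<Rightarrow> real) \<Rightarrow> ('x \<Rightarrow> real ^ 'p \<Rightarrow> real ^ 'm) \<Rightarrow>
   'x \<Rightarrow> real ^ 'p \<Rightarrow> real ^ 'm \<Rightarrow> bool" where
  "KKT g h x z l \<longleftrightarrow> grad_u h x z *v l = gradient (g x) z \<and> complementary (h x z) l"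

text \<open>The index type \<open>'p + 'm\<close> splits the \<open>p + m\<close> rows into the gradient block (\<^const>\<open>Inl\<close>)
  and the diagonal block (\<^const>\<open>Inr\<close>).\<close>

definition H_mat ::
  "('x \<Rightarrow> real ^ 'p \<Rightarrow> real ^ 'm) \<Rightarrow> 'x \<Rightarrow> real ^ 'p \<Rightarrow> real ^ 'm ^ ('p::finite + 'm::finite)" where
  "H_mat h x u = (\<chi> r i. case r of
      Inl k \<Rightarrow> gradient (\<lambda>v. h x v $ i) u $ k
    | Inr l \<Rightarrow> (if l = i then h x u $ i else 0))"

definition eta :: "('x \<Rightarrow> real ^ 'p \<Rightarrow> real) \<Rightarrow> 'x \<Rightarrow> real ^ 'p \<Rightarrow> real ^ ('p::finite + 'm::finite)" where
  "eta g x u = (\<chi> r. case r of Inl k \<Rightarrow> gradient (g x) u $ k | Inr l \<Rightarrow> 0)"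

definition multiplier_expr ::
  "('x \<Rightarrow> real ^ 'p \<Rightarrow> real ^ ('p::finite + 'm::finite) ^ 'm) \<Rightarrow> ('x \<Rightarrow> real ^ 'p \<Rightarrow> real) \<Rightarrow>
   ('x \<Rightarrow> real ^ 'p \<Rightarrow> real) \<Rightarrow> 'x \<Rightarrow> real ^ 'p \<Rightarrow> real ^ 'm" where
  "multiplier_expr T \<psi> g x u = (1 / \<psi> x u) *\<^sub>R (T x u *v eta g x u)"

definition gsip_feasible ::
  "'x set \<Rightarrow> ('s \<Rightarrow> 'x \<Rightarrow> real ^ 'p \<Rightarrow> real) \<Rightarrow> ('x \<Rightarrow> real ^ 'p \<Rightarrow> real ^ 'm) \<Rightarrow> 'x set" where
  "gsip_feasible X g h = {x \<in> X. \<forall>j. \<forall>u \<in> U_set h x. g j x u \<ge> 0}"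

text \<open>The requirement \<open>\<psi> x (z $ j) \<noteq> 0\<close> says that the rational expression
  \<^const>\<open>multiplier_expr\<close> is defined at the point, so that division by zero plays no role.\<close>

definition kkt_feasible ::
  "'x set \<Rightarrow> ('s::finite \<Rightarrow> 'x \<Rightarrow> real ^ 'p \<Rightarrow> real) \<Rightarrow> ('x \<Rightarrow> real ^ 'p \<Rightarrow> real ^ 'm) \<Rightarrow>
   ('x \<Rightarrow> real ^ 'p \<Rightarrow> real ^ ('p::finite + 'm::finite) ^ 'm) \<Rightarrow> ('x \<Rightarrow> real ^ 'p \<Rightarrow> real) \<Rightarrow>
   ('x \<times> (real ^ 'p ^ 's)) set" where
  "kkt_feasible X g h T \<psi> = {(x, z). x \<in> X \<and>
     (\<forall>j. \<psi> x (z $ j) \<noteq> 0 \<and>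
          grad_u h x (z $ j) *v multiplier_expr T \<psi> (g j) x (z $ j) = gradient (g j x) (z $ j) \<and>
          complementary (h x (z $ j)) (multiplier_expr T \<psi> (g j) x (z $ j)) \<and>
          g j x (z $ j) \<ge> 0)}"

end

theory Submission
  imports Defs
begin

text \<open>A KKT point of a convex program is a global minimizer: by convexity and differentiability,
  \<open>g u \<ge> g z + (u - z) \<bullet> \<nabla>g z = g z + (\<Sum>i. l\<^sub>i (u - z) \<bullet> \<nabla>h\<^sub>i z) \<ge> g z + (\<Sum>i. l\<^sub>i (h\<^sub>i u - h\<^sub>i z)) \<ge> g z\<close>
  on the feasible set, the last step using complementarity. So \<open>g\<^sub>j x\<close> is nonnegative on \<open>U(x)\<close> iff
  it is nonnegative at some (equivalently, every) KKT point. The feasible set of the semi-infinite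
  program is therefore the projection of that of the KKT program, and the objective does not depend
  on the projected variables.\<close>

text \<open>Freezing \<open>x\<close> amounts to composing \<open>q\<close> with the affine map
  \<open>Pair x\<close>, so the section \<open>q x\<close> is itself a polynomial function.\<close>

lemma poly2_differentiable:
  fixes q :: "'a::real_normed_vector \<Rightarrow> 'b::euclidean_space \<Rightarrow> real"
  assumes "poly2 q"
  shows "q x differentiable at u"
proof -
  have "polynomial_function (\<lambda>u::'b. (x, u))"
    unfolding polynomial_function_def
  proof (intro allI impI)
    fix k :: "'a \<times> 'b \<Rightarrow> real" assume "bounded_linear k"
    then interpret bounded_linear k .
    \<comment> \<open>By additivity, a linear functional of \<open>(x, u)\<close> is a constant plus
      a linear functional of \<open>u\<close>.\<close>
    have split: "(k \<circ> Pair x) = (\<lambda>u. k (x, 0) + k (0, u))"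
      by (simp add: fun_eq_iff flip: add)
    have "bounded_linear (\<lambda>u. k (0, u))"
      by (rule bounded_linear_compose[OF bounded_linear_axioms])
        (intro bounded_linear_Pair bounded_linear_zero bounded_linear_ident)
    then show "real_polynomial_function (k \<circ> Pair x)"
      unfolding split by (intro real_polynomial_function.intros)
  qed
  from real_polynomial_function_compose[OF this assms[unfolded poly2_def]]
  have "polynomial_function (q x)"
    by (simp add: o_def real_polynomial_function_eq)
  then show ?thesis
    by (rule differentiable_at_polynomial_function)
qed

text \<open>The denominator is nonzero along the whole section at \<open>x\<close>, so
  \<open>q x\<close> equals the quotient as a function and the quotient rule applies.\<close>

lemma rational2_differentiable:
  fixes q :: "'a::real_normed_vector \<Rightarrow> 'b::euclidean_space \<Rightarrow> real"
  assumes "rational2 q d" and nz: "\<And>v. d x v \<noteq> 0"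
  shows "q x differentiable at u"
proof -
  from assms obtain a where "poly2 a" "poly2 d" and q: "q x = (\<lambda>v. a x v / d x v)"
    unfolding rational2_def by fastforce
  then show ?thesis
    unfolding q by (intro differentiable_divide poly2_differentiable nz)
qed

lemma GDERIV_gradient:
  fixes f :: "'a::euclidean_space \<Rightarrow> real"
  assumes "f differentiable at u"
  shows "GDERIV f u :> gradient f u"
proof -
  obtain f' where f': "(f has_derivative f') (at u)"
    using assms unfolding differentiable_def by blast
  then interpret bounded_linear f'
    by (rule has_derivative_bounded_linear)
  \<comment> \<open>Riesz representation: applying the adjoint of the functional \<open>f'\<close>
    to 1 gives the vector representing it.\<close>
  have "f' = (\<lambda>h. h \<bullet> adjoint f' 1)"
    using adjoint_works[OF linear_axioms, of _ 1] by (simp add: fun_eq_iff)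
  then have "GDERIV f u :> adjoint f' 1"
    using f' by (simp add: gderiv_def)
  then show ?thesis
    by (simp add: gradient_eqI)
qed

text \<open>Restricting \<open>f\<close> to the line through \<open>z\<close> and \<open>u\<close>
  reduces this to the tangent inequality for a convex function of one real variable, with tangent
  point 0 evaluated at 1.\<close>

lemma convex_on_above_tangent_plane:
  assumes conv: "convex_on UNIV f" and deriv: "GDERIV f z :> D"
  shows "f z + (u - z) \<bullet> D \<le> f u"
proof -
  define \<phi> where "\<phi> t = f (z + t *\<^sub>R (u - z))" for t :: real
  have "convex_on UNIV \<phi>"
  proof (rule convex_onI)
    fix t a b :: real assume "0 < t" "t < 1"
    have "z + ((1 - t) *\<^sub>R a + t *\<^sub>R b) *\<^sub>R (u - z)
        = (1 - t) *\<^sub>R (z + a *\<^sub>R (u - z)) + t *\<^sub>R (z + b *\<^sub>R (u - z))"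
      by (simp add: algebra_simps)
    then show "\<phi> ((1 - t) *\<^sub>R a + t *\<^sub>R b) \<le> (1 - t) * \<phi> a + t * \<phi> b"
      unfolding \<phi>_def
      using convex_onD[OF conv, of t "z + a *\<^sub>R (u - z)" "z + b *\<^sub>R (u - z)"] \<open>0 < t\<close> \<open>t < 1\<close>
      by simp
  qed simp
  moreover have "(\<phi> has_real_derivative (u - z) \<bullet> D) (at 0)"
  proof -
    have "((\<lambda>t. z + t *\<^sub>R (u - z)) has_derivative (\<lambda>t. t *\<^sub>R (u - z))) (at 0)"
      by (auto intro!: derivative_eq_intros)
    \<comment> \<open>The base point is written as the value of the line at parameter 0, which is
      the form the chain rule expects.\<close>
    moreover have "(f has_derivative (\<lambda>h. h \<bullet> D)) (at (z + 0 *\<^sub>R (u - z)))"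
      using deriv by (simp add: gderiv_def)
    ultimately have "(\<phi> has_derivative (\<lambda>t. (t *\<^sub>R (u - z)) \<bullet> D)) (at 0)"
      unfolding \<phi>_def by (rule has_derivative_compose)
    then show ?thesis
      by (simp add: has_field_derivative_def mult_commute_abs)
  qed
  ultimately have "\<phi> 1 - \<phi> 0 \<ge> (u - z) \<bullet> D * (1 - 0)"
    by (intro convex_on_imp_above_tangent[where A = UNIV]) auto
  then show ?thesis
    by (simp add: \<phi>_def)
qed

text \<open>Turns the stationarity equation into a multiplier-weighted sum of directional
  derivatives of the constraints, to which concavity applies termwise.\<close>

lemma inner_grad_u_mult:
  "v \<bullet> (grad_u h x z *v l) = (\<Sum>i\<in>UNIV. l $ i * (v \<bullet> gradient (\<lambda>u. h x u $ i) z))"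
proof -
  have "v \<bullet> (grad_u h x z *v l)
      = (\<Sum>k\<in>UNIV. \<Sum>i\<in>UNIV. l $ i * (v $ k * gradient (\<lambda>u. h x u $ i) z $ k))"
    by (simp add: inner_vec_def grad_u_def matrix_vector_mult_def sum_distrib_left mult_ac)
  also have "\<dots> = (\<Sum>i\<in>UNIV. l $ i * (v \<bullet> gradient (\<lambda>u. h x u $ i) z))"
    by (subst sum.swap) (simp add: inner_vec_def sum_distrib_left)
  finally show ?thesis .
qed

lemma KKT_imp_minimal:
  assumes kkt: "KKT g h x z l"
    and g_conv: "convex_on UNIV (g x)" and g_diff: "g x differentiable at z"
    and h_conc: "\<And>i. concave_on UNIV (\<lambda>u. h x u $ i)"
    and h_diff: "\<And>i. (\<lambda>u. h x u $ i) differentiable at z"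
    and u: "u \<in> U_set h x"
  shows "g x z \<le> g x u"
proof -
  have l: "0 \<le> l $ i" for i
    using kkt by (simp add: KKT_def complementary_def)
  have compl: "(\<Sum>i\<in>UNIV. l $ i * h x z $ i) = 0"
    using kkt by (simp add: KKT_def complementary_def inner_vec_def mult.commute)
  have tangent: "h x u $ i - h x z $ i \<le> (u - z) \<bullet> gradient (\<lambda>u. h x u $ i) z" for i
  proof -
    \<comment> \<open>Concavity is convexity of the negated function, so the tangent inequality is
      applied to the negated constraint.\<close>
    have "GDERIV (\<lambda>u. - h x u $ i) z :> - gradient (\<lambda>u. h x u $ i) z"
      by (rule GDERIV_minus[OF GDERIV_gradient[OF h_diff]])
    from convex_on_above_tangent_plane[OF h_conc[of i, unfolded concave_on_def] this]
    show ?thesis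
      by (simp add: algebra_simps)
  qed
  have "0 \<le> (\<Sum>i\<in>UNIV. l $ i * h x u $ i)"
    using u l by (auto simp: U_set_def intro!: sum_nonneg)
  also have "\<dots> = (\<Sum>i\<in>UNIV. l $ i * (h x u $ i - h x z $ i))"
    using compl by (simp add: right_diff_distrib sum_subtractf)
  also have "\<dots> \<le> (\<Sum>i\<in>UNIV. l $ i * ((u - z) \<bullet> gradient (\<lambda>u. h x u $ i) z))"
    by (intro sum_mono mult_left_mono tangent l)
  also have "\<dots> = (u - z) \<bullet> gradient (g x) z"
    using kkt by (simp add: KKT_def flip: inner_grad_u_mult)
  finally show ?thesis
    using convex_on_above_tangent_plane[OF g_conv GDERIV_gradient[OF g_diff], of u] by simp
qed

text \<open>\<open>A\<close> is the image of \<open>B\<close> under \<open>fst\<close>, so both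
  infima range over the same values. In a complete lattice this also covers empty feasible sets and
  unbounded objectives.\<close>

lemma INF_projection:
  fixes f :: "'a \<Rightarrow> 'c::complete_lattice"
  assumes "\<And>x. x \<in> A \<longleftrightarrow> (\<exists>z. (x, z) \<in> B)"
  shows "(INF x\<in>A. f x) = (INF (x, z)\<in>B. f x)"
proof -
  have "A = fst ` B"
    using assms by force
  then show ?thesis
    by (simp add: image_image case_prod_beta)
qed

text \<open>Competitors in \<open>A\<close> and in \<open>B\<close> attain the same objective
  values, so every lift of a minimizer is a minimizer and conversely.\<close>

lemma is_arg_min_projection:
  assumes "\<And>x. x \<in> A \<longleftrightarrow> (\<exists>z. (x, z) \<in> B)"
  shows "is_arg_min f (\<lambda>x. x \<in> A) x \<longleftrightarrow> (\<exists>z. is_arg_min (\<lambda>(x, z). f x) (\<lambda>w. w \<in> B) (x, z))"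
  unfolding is_arg_min_def using assms by auto

theorem theorem5p2:
  fixes X :: "(real ^ 'n) set"
    and f :: "real ^ 'n \<Rightarrow> real"
    and g :: "'s::finite \<Rightarrow> real ^ 'n \<Rightarrow> real ^ 'p \<Rightarrow> real"
    and dg :: "'s \<Rightarrow> real ^ 'n \<Rightarrow> real ^ 'p \<Rightarrow> real"
    and h :: "real ^ 'n \<Rightarrow> real ^ 'p \<Rightarrow> real ^ 'm"
    and dh :: "'m \<Rightarrow> real ^ 'n \<Rightarrow> real ^ 'p \<Rightarrow> real"
    and T :: "real ^ 'n \<Rightarrow> real ^ 'p \<Rightarrow> real ^ ('p::finite + 'm::finite) ^ 'm"
    and \<psi> :: "real ^ 'n \<Rightarrow> real ^ 'p \<Rightarrow> real"
  assumes X: "polynomial_constraint_set X"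
    and f: "real_polynomial_function f"
    and g_rational: "\<And>j. rational2 (g j) (dg j)"
    and h_rational: "\<And>i. rational2 (\<lambda>x u. h x u $ i) (dh i)"
    and g_defined: "\<And>j x u. x \<in> X \<Longrightarrow> dg j x u \<noteq> 0"
    and h_defined: "\<And>i x u. x \<in> X \<Longrightarrow> dh i x u \<noteq> 0"
    and g_convex: "\<And>j x. x \<in> X \<Longrightarrow> convex_on UNIV (g j x)"
    and h_concave: "\<And>i x. x \<in> X \<Longrightarrow> concave_on UNIV (\<lambda>u. h x u $ i)"
    and T_poly: "\<And>i r. poly2 (\<lambda>x u. T x u $ i $ r)"
    and \<psi>_poly: "poly2 \<psi>"
    and \<psi>_nonzero: "\<exists>x u. \<psi> x u \<noteq> 0"
    and T_H: "\<And>x u. (\<forall>i. dh i x u \<noteq> 0) \<Longrightarrow> T x u ** H_mat h x u = \<psi> x u *\<^sub>R mat 1"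
    and KKT_minimizer: "\<And>x j. x \<in> X \<Longrightarrow>
      \<exists>z l. is_arg_min (g j x) (\<lambda>u. u \<in> U_set h x) z \<and> KKT (g j) h x z l \<and>
            \<psi> x z \<noteq> 0 \<and> l = multiplier_expr T \<psi> (g j) x z"
  shows "(\<forall>x. x \<in> gsip_feasible X g h \<longleftrightarrow> (\<exists>z. (x, z) \<in> kkt_feasible X g h T \<psi>)) \<and>
    (INF x \<in> gsip_feasible X g h. ereal (f x)) =
      (INF (x, z) \<in> kkt_feasible X g h T \<psi>. ereal (f x)) \<and>
    (\<forall>x. is_arg_min f (\<lambda>x. x \<in> gsip_feasible X g h) x \<longleftrightarrow>
      (\<exists>z. is_arg_min (\<lambda>(x, z). f x) (\<lambda>w. w \<in> kkt_feasible X g h T \<psi>) (x, z)))"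
proof -
  have feasible_iff: "x \<in> gsip_feasible X g h \<longleftrightarrow> (\<exists>z. (x, z) \<in> kkt_feasible X g h T \<psi>)" for x
  proof
    assume feas: "x \<in> gsip_feasible X g h"
    then have x: "x \<in> X"
      by (simp add: gsip_feasible_def)
    \<comment> \<open>Membership of \<open>z\<close> in \<open>U_set h x\<close> is recorded because
      the semi-infinite constraint at \<open>u = z\<close> then yields the sign condition on
      \<open>g j x z\<close>.\<close>
    have "\<exists>z. z \<in> U_set h x \<and> KKT (g j) h x z (multiplier_expr T \<psi> (g j) x z) \<and> \<psi> x z \<noteq> 0" for j
      using KKT_minimizer[OF x, of j] by (auto simp: is_arg_min_def)
    then obtain z where z: "\<And>j. z j \<in> U_set h x \<and>
        KKT (g j) h x (z j) (multiplier_expr T \<psi> (g j) x (z j)) \<and> \<psi> x (z j) \<noteq> 0"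
      by metis
    then have "(x, \<chi> j. z j) \<in> kkt_feasible X g h T \<psi>"
      using feas by (auto simp: kkt_feasible_def gsip_feasible_def KKT_def)
    then show "\<exists>z. (x, z) \<in> kkt_feasible X g h T \<psi>" ..
  next
    assume "\<exists>z. (x, z) \<in> kkt_feasible X g h T \<psi>"
    then obtain z where x: "x \<in> X" and nonneg: "\<And>j. 0 \<le> g j x (z $ j)"
      and kkt: "\<And>j. KKT (g j) h x (z $ j) (multiplier_expr T \<psi> (g j) x (z $ j))"
      by (auto simp: kkt_feasible_def KKT_def)
    \<comment> \<open>Here each \<open>z $ j\<close> is an arbitrary KKT point; convexity makes it a
      global minimizer, so its nonnegative value bounds \<open>g j x\<close> from below on
      \<open>U_set h x\<close>.\<close>
    have "0 \<le> g j x u" if "u \<in> U_set h x" for j u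
    proof -
      have "g j x (z $ j) \<le> g j x u"
      proof (rule KKT_imp_minimal[where l = "multiplier_expr T \<psi> (g j) x (z $ j)"])
        show "g j x differentiable at (z $ j)"
          using g_rational g_defined[OF x] by (rule rational2_differentiable)
        show "(\<lambda>u. h x u $ i) differentiable at (z $ j)" for i
          using h_rational h_defined[OF x] by (rule rational2_differentiable)
      qed (use kkt g_convex[OF x] h_concave[OF x] that in auto)
      with nonneg[of j] show ?thesis
        by simp
    qed
    then show "x \<in> gsip_feasible X g h"
      using x by (simp add: gsip_feasible_def)
  qed
  show ?thesis
    using feasible_iff INF_projection[OF feasible_iff] is_arg_min_projection[OF feasible_iff] by blast
qed

end
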